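(* Let $P$ be a regular $n$-gon and let $m\ge 2$ be an integer. Then there is a point $S$ on the perimeter of $P$ such that the Area Chordal System determined by $S$ produces a regular sub-$n$-gon $T$ of $P$ satisfying $(P)/(T)=m$.
   Context: For a polygon $X$, $(X)$ denotes the area of $X$. Area Chordal System: let $P$ be a regular $n$-gon ($n\ge 3$) and let $A$ be a vertex of $P$. Let $S$ be a point on an opposite side of $P$ from $A$, meaning a side of $P$ that does not contain $A$, and let $c=AS$ be the chord (segment) from $A$ to $S$. This chord is copied to each of the other vertices of $P$ by rotating it about the center of $P$ by successive multiples of the angle $360^\circ/n$, which gives a system of $n$ chords, one from each vertex. These $n$ chords are the Area Chordal System determined by $S$. Their intersections form a regular sub-$n$-gon $T$ of $P$: it is the innermost one, i.e. the regular $n$-gon concentric with $P$ that is the region containing the center of $P$ and bounded by the $n$ chords. It is nondegenerate when $AS$ does not pass through the center of $P$. This $T$ is the sub-$n$-gon produced (determined) by the system. *)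

theory Defs
  imports "HOL-Analysis.Analysis"
begin

definition rotate_about :: "complex \<Rightarrow> real \<Rightarrow> complex \<Rightarrow> complex" where
  "rotate_about c \<theta> z = c + cis \<theta> * (z - c)"

text \<open>The Euclidean plane is \<^typ>\<open>complex\<close>. A polygon is the closed convex region, not just its
  boundary; its vertices are its extreme points, its sides are its edges in the sense of
  \<open>edge_of\<close>, and its perimeter is its frontier.\<close>

definition regular_ngon :: "nat \<Rightarrow> complex \<Rightarrow> complex set \<Rightarrow> bool" where
  "regular_ngon n c P \<longleftrightarrow> n \<ge> 3 \<and>
     (\<exists>v. v \<noteq> c \<and> P = convex hull ((\<lambda>k. rotate_about c (2 * pi * real k / real n) v) ` {..<n}))"

definition on_opposite_side :: "complex set \<Rightarrow> complex \<Rightarrow> complex \<Rightarrow> bool" where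
  "on_opposite_side P A S \<longleftrightarrow> (\<exists>e. e edge_of P \<and> A \<notin> e \<and> S \<in> e)"

definition area_chordal_system ::
    "nat \<Rightarrow> complex \<Rightarrow> complex \<Rightarrow> complex \<Rightarrow> complex set set" where
  "area_chordal_system n c A S =
     (\<lambda>k. rotate_about c (2 * pi * real k / real n) ` closed_segment A S) ` {..<n}"

text \<open>The closed region around the centre \<open>c\<close> cut out by the chords. It is empty in the
  degenerate case where the chords pass through \<open>c\<close>.\<close>

definition produced_polygon :: "nat \<Rightarrow> complex \<Rightarrow> complex \<Rightarrow> complex \<Rightarrow> complex set" where
  "produced_polygon n c A S =
     closure (connected_component_set (- \<Union> (area_chordal_system n c A S)) c)"

end

theory Submission
  imports Defs
begin

text \<open>
  After a similarity the centre is \<open>0\<close>, the chosen vertex is \<open>1\<close>, and \<open>P\<close> is the convex hull of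
  the \<open>n\<close>-th roots of unity, whose inradius is \<open>r = cos (\<pi>/n)\<close>. Let \<open>cis \<phi>\<close> be the unit normal of
  the chord from \<open>1\<close>, so that the chord has distance \<open>d = cos \<phi>\<close> from the centre. The rotated chords
  then bound a regular \<open>n\<close>-gon of inradius \<open>d\<close>, and the ratio of the areas is \<open>(r/d)\<^sup>2\<close>. Thus the right
  choice is \<open>d = r / sqrt m\<close>, which lies strictly between \<open>0\<close> and \<open>r\<close>, that is
  \<open>\<pi>/n < \<phi> < \<pi>/2\<close>.

  What needs an argument is that the chords, which are segments and not lines, are long enough to
  contain the sides of this \<open>n\<close>-gon. As a chord is everything that its ray from \<open>1\<close> has in common
  with \<open>P\<close>, it suffices that the vertices of the inner polygon lie in \<open>P\<close>. That inner polygon is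
  \<open>b P\<close> with \<open>b = (d/r) cis (\<phi> - \<pi>/n)\<close>, and the side inequalities of \<open>P\<close> at the points \<open>b w\<^sup>j\<close>, with
  \<open>w = cis (2\<pi>/n)\<close>, read \<open>cos \<phi> cos (2\<pi>l/n - \<phi>) \<le> cos\<^sup>2 (\<pi>/n)\<close> for integers \<open>l\<close>. If \<open>n\<close> divides
  \<open>l\<close> this is \<open>d \<le> r\<close>; otherwise, doubled, it is
  \<open>cos (2\<pi>l/n) + cos (2\<phi> - 2\<pi>l/n) \<le> cos (2\<pi>/n) + 1\<close>
  (\<open>inscribed_vertex_in_unit_ngon\<close>). Note that the circumcircle of the inner polygon need not lie in
  \<open>P\<close>, for instance when \<open>n = 3\<close> and \<open>m = 2\<close>, so comparing radii is not enough.

  The point \<open>S\<close> is the last point of \<open>P\<close> on the ray (\<open>chord_endpoint\<close>). It lies on some side of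
  \<open>P\<close>; if that side contained \<open>1\<close> too, then the line of the side would be the line of the chord,
  although these have the different distances \<open>r\<close> and \<open>d\<close> from the centre.

  Finally the interior of the inner polygon avoids the chords while its frontier is covered by
  them, so it is the component of the centre (\<open>produced_polygon_eq\<close>); the inner polygon is the
  image of \<open>P\<close> under a similarity of ratio \<open>|b| = d/r\<close>, which gives the areas.
\<close>

section \<open>Cosines and inner products of unit vectors\<close>

text \<open>Modulo a full turn, a multiple of the step \<open>2\<pi>/N\<close> that is not a full turn itself is at least one
  step away from \<open>0\<close> on either side. With \<open>N = n\<close> this compares the vertices of the \<open>n\<close>-gon with
  each other, with \<open>N = 2n\<close> the vertices with the side normals.\<close>

lemma cos_multiple_le_cos_step:
  fixes N :: nat and q :: int
  assumes N: "N \<ge> 2" and q: "\<not> int N dvd q"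
  shows "cos (2 * pi * of_int q / real N) \<le> cos (2 * pi / real N)"
proof -
  define s where "s = q mod int N"
  define l where "l = q div int N"
  have ql: "q = s + l * int N"
    by (simp add: s_def l_def)
  have "s \<noteq> 0" "0 \<le> s" "s < int N"
    using N q by (auto simp: s_def dvd_eq_mod_eq_0)
  then have s: "1 \<le> s" "s \<le> int N - 1"
    by linarith+
  define x where "x = 2 * pi * of_int s / real N"
  define \<delta> where "\<delta> = 2 * pi / real N"
  have \<delta>: "0 \<le> \<delta>" by (simp add: \<delta>_def)
  have "2 * pi * of_int q / real N = x + of_int l * (2 * pi)"
    using N by (simp add: ql x_def field_simps)
  then have eq: "cos (2 * pi * of_int q / real N) = cos x"
    using cos.plus_of_int[of x l] by (simp only: of_real_eq_id id_apply)
  have x: "x = of_int s * \<delta>" by (simp add: x_def \<delta>_def)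
  have full: "real N * \<delta> = 2 * pi" using N by (simp add: \<delta>_def)
  have "1 \<le> real_of_int s" "real_of_int s \<le> real N - 1"
    using s by linarith+
  then have lower: "\<delta> \<le> x" and "x \<le> (real N - 1) * \<delta>"
    using \<delta> mult_right_mono[of 1 "real_of_int s" \<delta>] mult_right_mono[of "real_of_int s" "real N - 1" \<delta>]
    by (auto simp: x)
  then have upper: "x \<le> 2 * pi - \<delta>"
    using full by (simp add: algebra_simps)
  have "cos x \<le> cos \<delta>"
  proof (cases "x \<le> pi")
    case True
    then show ?thesis using \<delta> lower by (simp add: cos_monotone_0_pi_le)
  next
    case False
    have "cos x = cos (2 * pi - x)" by (simp add: cos_diff)
    also have "\<dots> \<le> cos \<delta>"
      using \<delta> False upper by (intro cos_monotone_0_pi_le) auto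
    finally show ?thesis .
  qed
  then show ?thesis by (simp add: eq \<delta>_def)
qed

lemma inner_cis_rotate: "inner (cis (\<alpha> + \<beta>)) (cis \<beta> * z) = inner (cis \<alpha>) z"
proof -
  have expand: "(a * C - b * S) * (C * x - S * y) + (b * C + a * S) * (C * y + S * x)
      = (C * C + S * S) * (a * x + b * y)" for a b C S x y :: real
    by (simp add: algebra_simps)
  have "cos \<beta> * cos \<beta> + sin \<beta> * sin \<beta> = 1"
    using sin_cos_squared_add2[of \<beta>] by (simp add: power2_eq_square)
  then show ?thesis
    using expand[of "cos \<alpha>" "cos \<beta>" "sin \<alpha>" "sin \<beta>" "Re z" "Im z"]
    by (simp add: inner_complex_def cos_add sin_add)
qed

lemma inner_cis_cis: "inner (cis \<alpha>) (cis \<beta>) = cos (\<alpha> - \<beta>)"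
  by (simp add: inner_complex_def cos_diff)

section \<open>The regular polygon on the roots of unity\<close>

text \<open>Vertices are indexed by integers, and so cyclically, which avoids a special case for the side
  that joins the last vertex to the first.\<close>

definition unit_vertex :: "nat \<Rightarrow> int \<Rightarrow> complex" where
  "unit_vertex n k = cis (2 * pi * of_int k / real n)"

definition unit_ngon :: "nat \<Rightarrow> complex set" where
  "unit_ngon n = convex hull (range (unit_vertex n))"

text \<open>The outer unit normal of the side from vertex \<open>k\<close> to vertex \<open>k + 1\<close>.\<close>

definition side_normal :: "nat \<Rightarrow> int \<Rightarrow> complex" where
  "side_normal n k = cis ((2 * of_int k + 1) * pi / real n)"

lemma unit_vertex_0 [simp]: "unit_vertex n 0 = 1"
  by (simp add: unit_vertex_def)

lemma unit_vertex_nonzero [simp]: "unit_vertex n k \<noteq> 0"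
  by (simp add: unit_vertex_def)

lemma unit_vertex_add: "unit_vertex n (j + k) = unit_vertex n j * unit_vertex n k"
  by (simp add: unit_vertex_def cis_mult field_simps add_divide_distrib)

lemma unit_vertex_mod:
  assumes "n > 0"
  shows "unit_vertex n (k mod int n) = unit_vertex n k"
proof -
  have "unit_vertex n (int n * l) = 1" for l
    using assms cis_multiple_2pi[of "of_int l"] by (simp add: unit_vertex_def mult_ac)
  then show ?thesis
    by (metis mod_mult_div_eq mult.right_neutral unit_vertex_add)
qed

lemma range_unit_vertex:
  assumes "n > 0"
  shows "range (unit_vertex n) = (\<lambda>k. unit_vertex n (int k)) ` {..<n}"
proof -
  have "unit_vertex n k \<in> (\<lambda>k. unit_vertex n (int k)) ` {..<n}" for k
    by (rule image_eqI[where x = "nat (k mod int n)"])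
       (use assms in \<open>auto simp: unit_vertex_mod nat_less_iff\<close>)
  then show ?thesis by auto
qed

lemma range_unit_vertex_rotate:
  "(\<lambda>z. unit_vertex n j * z) ` range (unit_vertex n) = range (unit_vertex n)"
proof -
  have "unit_vertex n k = unit_vertex n j * unit_vertex n (k - j)" for k
    by (metis add.commute diff_add_cancel unit_vertex_add)
  then have "range (unit_vertex n) \<subseteq> (\<lambda>z. unit_vertex n j * z) ` range (unit_vertex n)"
    by blast
  then show ?thesis by (auto simp flip: unit_vertex_add)
qed

lemma unit_vertex_in_unit_ngon: "unit_vertex n k \<in> unit_ngon n"
  unfolding unit_ngon_def by (rule hull_inc) simp

lemma convex_unit_ngon: "convex (unit_ngon n)"
  by (simp add: unit_ngon_def)

lemma compact_unit_ngon: "n > 0 \<Longrightarrow> compact (unit_ngon n)"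
  by (simp add: unit_ngon_def range_unit_vertex finite_imp_compact_convex_hull)

lemma unit_ngon_rotate: "(\<lambda>z. unit_vertex n j * z) ` unit_ngon n = unit_ngon n"
  unfolding unit_ngon_def
  by (subst convex_hull_linear_image) (simp_all add: range_unit_vertex_rotate linear_times)

lemma side_normal_shift: "side_normal n (k + j) = cis ((2 * of_int k + 1) * pi / real n + 2 * pi * of_int j / real n)"
  by (simp add: side_normal_def field_simps add_divide_distrib)

lemma inner_side_normal_rotate:
  "inner (side_normal n (k + j)) (unit_vertex n j * z) = inner (side_normal n k) z"
  unfolding side_normal_shift unit_vertex_def inner_cis_rotate by (simp add: side_normal_def)

lemma side_normal_nonzero [simp]: "side_normal n k \<noteq> 0"
  by (simp add: side_normal_def)

lemma inner_side_normal_left: "n > 0 \<Longrightarrow> inner (side_normal n k) (unit_vertex n k) = cos (pi / real n)"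
  by (simp add: side_normal_def unit_vertex_def inner_cis_cis field_simps)

lemma inner_side_normal_right: "n > 0 \<Longrightarrow> inner (side_normal n k) (unit_vertex n (k + 1)) = cos (pi / real n)"
proof -
  assume "n > 0"
  have "(2 * of_int k + 1) * pi / real n - 2 * pi * of_int (k + 1) / real n = - (pi / real n)"
    using \<open>n > 0\<close> by (simp add: field_simps)
  then show ?thesis by (simp only: side_normal_def unit_vertex_def inner_cis_cis cos_minus)
qed

lemma unit_ngon_halfplane:
  assumes n: "n \<ge> 3" and z: "z \<in> unit_ngon n"
  shows "inner (side_normal n k) z \<le> cos (pi / real n)"
proof -
  have "unit_ngon n \<subseteq> {z. inner (side_normal n k) z \<le> cos (pi / real n)}"
    unfolding unit_ngon_def
  proof (rule hull_minimal)
    show "range (unit_vertex n) \<subseteq> {z. inner (side_normal n k) z \<le> cos (pi / real n)}"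
    proof safe
      fix j :: int
      have eq: "(2 * of_int k + 1) * pi / real n - 2 * pi * of_int j / real n
          = 2 * pi * of_int (2 * (k - j) + 1) / real (2 * n)"
        using n by (simp add: field_simps)
      have "odd (2 * (k - j) + 1)" by simp
      \<comment> \<open>Relative to a normal, vertices sit at odd multiples of \<open>\<pi>/n\<close>, and \<open>2n\<close> divides no odd number.\<close>
      moreover have "2 dvd int (2 * n)" by simp
      ultimately have "\<not> int (2 * n) dvd (2 * (k - j) + 1)"
        using dvd_trans by blast
      then have "cos (2 * pi * of_int (2 * (k - j) + 1) / real (2 * n)) \<le> cos (2 * pi / real (2 * n))"
        using n by (intro cos_multiple_le_cos_step) auto
      then show "inner (side_normal n k) (unit_vertex n j) \<le> cos (pi / real n)"
        unfolding side_normal_def unit_vertex_def inner_cis_cis eq by simp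
    qed
  qed (rule convex_halfspace_le)
  then show ?thesis using z by blast
qed

text \<open>The cones spanned by two neighbouring vertices cover the plane. With respect to the cone that
  contains \<open>z\<close>, the number \<open>s + t\<close> is the gauge of \<open>z\<close>: membership in the polygon and on its
  frontier, and the value of the side functional, can all be read off from it.\<close>

lemma cone_decomposition:
  assumes n: "n \<ge> 3"
  obtains k :: int and s t :: real where "0 \<le> s" "0 \<le> t"
    "z = s *\<^sub>R unit_vertex n k + t *\<^sub>R unit_vertex n (k + 1)"
proof -
  define \<delta> where "\<delta> = 2 * pi / real n"
  have \<delta>: "0 < \<delta>" "\<delta> < pi"
    using n by (auto simp: \<delta>_def field_simps)
  define \<theta> where "\<theta> = Arg2pi z"
  define k where "k = \<lfloor>\<theta> / \<delta>\<rfloor>"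
  define x where "x = \<theta> - of_int k * \<delta>"
  have "of_int k \<le> \<theta> / \<delta>" "\<theta> / \<delta> < of_int k + 1"
    by (simp_all add: k_def floor_correct)
  then have x: "0 \<le> x" "x \<le> \<delta>"
    using \<delta> by (auto simp: x_def field_simps)
  have sin: "sin \<delta> > 0" using \<delta> by (simp add: sin_gt_zero)
  \<comment> \<open>Coordinates of \<open>cis x\<close> in the basis \<open>1\<close>, \<open>cis \<delta>\<close>, by Cramer's rule.\<close>
  have base: "cis x = (sin (\<delta> - x) / sin \<delta>) *\<^sub>R 1 + (sin x / sin \<delta>) *\<^sub>R cis \<delta>"
    using sin by (simp add: complex_eq_iff sin_diff field_simps)
  have vk: "unit_vertex n k = cis (of_int k * \<delta>)" "unit_vertex n (k + 1) = cis (of_int k * \<delta>) * cis \<delta>"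
    by (simp_all add: unit_vertex_def \<delta>_def cis_mult field_simps add_divide_distrib)
  have "cis \<theta> = cis (of_int k * \<delta>) * cis x"
    by (simp add: cis_mult x_def)
  also have "\<dots> = (sin (\<delta> - x) / sin \<delta>) *\<^sub>R unit_vertex n k + (sin x / sin \<delta>) *\<^sub>R unit_vertex n (k + 1)"
    unfolding base vk by (simp add: algebra_simps)
  finally have c: "cis \<theta> = \<dots>" .
  have "z = norm z *\<^sub>R cis \<theta>"
    using Arg2pi_eq[of z] by (simp add: \<theta>_def cis_conv_exp scaleR_conv_of_real)
  also have "\<dots> = (norm z * (sin (\<delta> - x) / sin \<delta>)) *\<^sub>R unit_vertex n k
      + (norm z * (sin x / sin \<delta>)) *\<^sub>R unit_vertex n (k + 1)"
    unfolding c by (simp add: scaleR_add_right)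
  finally show ?thesis
    using that sin x \<delta> by (smt (verit) divide_nonneg_pos mult_nonneg_nonneg norm_ge_zero sin_ge_zero)
qed

text \<open>Writing \<open>-1\<close> in one of the cones gives a positive combination of vertices that equals \<open>0\<close>,
  since \<open>1\<close> is a vertex.\<close>

lemma zero_in_unit_ngon:
  assumes "n \<ge> 3"
  shows "0 \<in> unit_ngon n"
proof -
  obtain k s t where st: "0 \<le> s" "0 \<le> t"
    and eq: "- 1 = s *\<^sub>R unit_vertex n k + t *\<^sub>R unit_vertex n (k + 1)"
    using cone_decomposition[OF assms, of "-1"] by metis
  have "(s / (s + t)) *\<^sub>R unit_vertex n k + (t / (s + t)) *\<^sub>R unit_vertex n (k + 1) \<in> unit_ngon n"
    if "s + t > 0"
    using st that
    by (intro convexD[OF convex_unit_ngon] unit_vertex_in_unit_ngon) (auto simp: add_divide_distrib[symmetric])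
  moreover have pos: "s + t > 0"
  proof (rule ccontr)
    assume "\<not> s + t > 0"
    then have "s = 0" "t = 0" using st by auto
    then show False using eq by simp
  qed
  moreover have "(s / (s + t)) *\<^sub>R unit_vertex n k + (t / (s + t)) *\<^sub>R unit_vertex n (k + 1) = (1 / (s + t)) *\<^sub>R (-1)"
    unfolding eq by (simp add: scaleR_add_right)
  ultimately have "(1 / (s + t)) *\<^sub>R (-1) \<in> unit_ngon n" by simp
  then have "(1 / (1 + (s + t))) *\<^sub>R 1 + ((s + t) / (1 + (s + t))) *\<^sub>R (1 / (s + t)) *\<^sub>R (-1) \<in> unit_ngon n"
    using unit_vertex_in_unit_ngon[of n 0] st
    by (intro convexD[OF convex_unit_ngon]) (auto simp: add_divide_distrib[symmetric])
  then show ?thesis using pos by simp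
qed

lemma inner_side_normal_cone:
  assumes "n > 0"
  shows "inner (side_normal n k) (s *\<^sub>R unit_vertex n k + t *\<^sub>R unit_vertex n (k + 1)) = (s + t) * cos (pi / real n)"
  using assms by (simp add: inner_add_right inner_side_normal_left inner_side_normal_right distrib_right)

lemma cone_in_unit_ngon:
  assumes "n \<ge> 3" "0 \<le> s" "0 \<le> t" "s + t \<le> 1"
  shows "s *\<^sub>R unit_vertex n k + t *\<^sub>R unit_vertex n (k + 1) \<in> unit_ngon n"
proof -
  have "convex hull {0, unit_vertex n k, unit_vertex n (k + 1)} \<subseteq> unit_ngon n"
    using zero_in_unit_ngon[OF assms(1)] unit_vertex_in_unit_ngon convex_unit_ngon
    by (intro hull_minimal) auto
  moreover have "s *\<^sub>R unit_vertex n k + t *\<^sub>R unit_vertex n (k + 1)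
      \<in> convex hull {0, unit_vertex n k, unit_vertex n (k + 1)}"
    unfolding convex_hull_3 using assms
    by (intro CollectI exI[of _ "1 - s - t"] exI[of _ s] exI[of _ t]) auto
  ultimately show ?thesis by blast
qed

lemma cos_pi_over_pos: "n \<ge> 3 \<Longrightarrow> 0 < cos (pi / real n)"
  by (intro cos_gt_zero_pi) (auto simp: field_simps intro: less_le_trans[of _ 0])

text \<open>The side inequality of the cone that contains \<open>z\<close> already bounds the gauge of \<open>z\<close> by \<open>1\<close>.\<close>

lemma in_unit_ngon_if_halfplanes:
  assumes n: "n \<ge> 3" and z: "\<And>k. inner (side_normal n k) z \<le> cos (pi / real n)"
  shows "z \<in> unit_ngon n"
proof -
  obtain k s t where st: "0 \<le> s" "0 \<le> t"
    and eq: "z = s *\<^sub>R unit_vertex n k + t *\<^sub>R unit_vertex n (k + 1)"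
    using cone_decomposition[OF n] by metis
  have "(s + t) * cos (pi / real n) \<le> 1 * cos (pi / real n)"
    using z[of k] n by (simp add: eq inner_side_normal_cone)
  then have "s + t \<le> 1"
    using cos_pi_over_pos[OF n] mult_le_cancel_right_pos by blast
  then show ?thesis
    unfolding eq using cone_in_unit_ngon n st by blast
qed

text \<open>The inscribed disc satisfies all side inequalities.\<close>

lemma zero_interior_unit_ngon:
  assumes n: "n \<ge> 3"
  shows "0 \<in> interior (unit_ngon n)"
proof -
  have "ball 0 (cos (pi / real n)) \<subseteq> unit_ngon n"
  proof
    fix z :: complex assume "z \<in> ball 0 (cos (pi / real n))"
    moreover have "inner (side_normal n k) z \<le> norm z" for k
      using norm_cauchy_schwarz[of "side_normal n k" z] by (simp add: side_normal_def)
    ultimately show "z \<in> unit_ngon n"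
      by (intro in_unit_ngon_if_halfplanes n) (auto intro: order_trans[OF _ less_imp_le])
  qed
  then show ?thesis
    using cos_pi_over_pos[OF n] by (auto simp: mem_interior)
qed

text \<open>A point of gauge less than \<open>1\<close> is a point of the polygon shrunk towards the interior point \<open>0\<close>,
  hence interior; gauge \<open>1\<close> means lying on a side.\<close>

lemma frontier_unit_ngon:
  assumes n: "n \<ge> 3" and z: "z \<in> frontier (unit_ngon n)"
  obtains k where "z \<in> closed_segment (unit_vertex n k) (unit_vertex n (k + 1))"
proof -
  have zP: "z \<in> unit_ngon n"
    using z n compact_unit_ngon[of n] by (simp add: frontier_def compact_imp_closed)
  obtain k s t where st: "0 \<le> s" "0 \<le> t"
    and eq: "z = s *\<^sub>R unit_vertex n k + t *\<^sub>R unit_vertex n (k + 1)"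
    using cone_decomposition[OF n] by metis
  have "(s + t) * cos (pi / real n) \<le> 1 * cos (pi / real n)"
    using unit_ngon_halfplane[OF n zP, of k] n by (simp add: eq inner_side_normal_cone)
  then have le: "s + t \<le> 1"
    using cos_pi_over_pos[OF n] mult_le_cancel_right_pos by blast
  have "s + t = 1"
  proof (rule ccontr)
    assume "s + t \<noteq> 1"
    then have lt: "s + t < 1" using le by simp
    have "z \<in> interior (unit_ngon n)"
    proof (cases "s + t = 0")
      case True
      then have "z = 0" using st eq by (simp add: add_nonneg_eq_0_iff)
      then show ?thesis using zero_interior_unit_ngon[OF n] by simp
    next
      case False
      define y where "y = (s / (s + t)) *\<^sub>R unit_vertex n k + (t / (s + t)) *\<^sub>R unit_vertex n (k + 1)"
      have "y \<in> unit_ngon n"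
        unfolding y_def using False st n
        by (intro cone_in_unit_ngon) (auto simp: add_divide_distrib[symmetric])
      then have "y - (1 - (s + t)) *\<^sub>R (y - 0) \<in> interior (unit_ngon n)"
        using lt st n by (intro mem_interior_convex_shrink convex_unit_ngon zero_interior_unit_ngon) auto
      moreover have "y - (1 - (s + t)) *\<^sub>R (y - 0) = (s + t) *\<^sub>R y"
        by (simp add: algebra_simps)
      moreover have "(s + t) *\<^sub>R y = z"
        using False by (simp add: y_def eq scaleR_add_right)
      ultimately show ?thesis by simp
    qed
    then show False using z by (simp add: frontier_def)
  qed
  then have "z \<in> closed_segment (unit_vertex n k) (unit_vertex n (k + 1))"
    unfolding closed_segment_def using st eq by (intro CollectI exI[of _ t]) auto
  then show ?thesis by (rule that)
qed

lemma unit_ngon_edge: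
  assumes n: "n \<ge> 3"
  shows "(unit_ngon n \<inter> {z. inner (side_normal n k) z = cos (pi / real n)}) edge_of unit_ngon n"
    (is "?e edge_of _")
  unfolding edge_of_def
proof
  show "?e face_of unit_ngon n"
    by (intro face_of_Int_supporting_hyperplane_le convex_unit_ngon unit_ngon_halfplane n)
  have ne: "unit_vertex n k \<noteq> unit_vertex n (k + 1)"
  proof
    assume "unit_vertex n k = unit_vertex n (k + 1)"
    then have "unit_vertex n 1 = 1" by (simp add: unit_vertex_add)
    then have "cos (2 * pi / real n) = 1" by (simp add: unit_vertex_def complex_eq_iff)
    moreover have "cos (2 * pi / real n) < cos 0"
      using n by (intro cos_monotone_0_pi) (auto simp: field_simps)
    ultimately show False by simp
  qed
  have "aff_dim {unit_vertex n k, unit_vertex n (k + 1)} \<le> aff_dim ?e"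
    using n by (intro aff_dim_subset) (auto simp: unit_vertex_in_unit_ngon inner_side_normal_left inner_side_normal_right)
  then have "1 \<le> aff_dim ?e" using ne by (simp add: aff_dim_2)
  moreover have "aff_dim ?e \<le> aff_dim {z. inner (side_normal n k) z = cos (pi / real n)}"
    by (intro aff_dim_subset) auto
  moreover have "aff_dim {z. inner (side_normal n k) z = cos (pi / real n)} = 1"
    by (subst aff_dim_hyperplane) auto
  ultimately show "aff_dim ?e = 1" by simp
qed

section \<open>The inscribed polygon and the chord\<close>

text \<open>The vertex at which the inner polygon first meets the chord from \<open>1\<close>: that polygon has inradius
  \<open>cos \<phi>\<close>, hence circumradius \<open>cos \<phi> / cos (\<pi>/n)\<close>, and its side on the chord has normal
  \<open>cis \<phi>\<close>, hence endpoints with arguments \<open>\<phi> - \<pi>/n\<close> and \<open>\<phi> + \<pi>/n\<close>.\<close>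

definition inscribed_vertex :: "nat \<Rightarrow> real \<Rightarrow> complex" where
  "inscribed_vertex n \<phi> = (cos \<phi> / cos (pi / real n)) *\<^sub>R cis (\<phi> - pi / real n)"

text \<open>The product formula turns the side inequality into a bound on \<open>cos x + cos (2\<phi> - x)\<close> with \<open>x\<close> a
  multiple of \<open>2\<pi>/n\<close>. The two summands are bounded separately, except when \<open>x\<close> is a full turn: then
  \<open>cos x\<close> is too large, and the inequality is \<open>cos \<phi> \<le> cos (\<pi>/n)\<close> squared.\<close>

lemma inscribed_vertex_in_unit_ngon:
  assumes n: "n \<ge> 3" and \<phi>: "pi / real n \<le> \<phi>" "\<phi> \<le> pi / 2"
  shows "inscribed_vertex n \<phi> * unit_vertex n j \<in> unit_ngon n"
proof (rule in_unit_ngon_if_halfplanes[OF n])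
  fix k :: int
  define r where "r = cos (pi / real n)"
  \<comment> \<open>Number of steps from vertex \<open>j\<close> to vertex \<open>k + 1\<close>; the offsets \<open>\<pi>/n\<close> of the side normal and of \<open>inscribed_vertex\<close> add up to one more step.\<close>
  define l where "l = k + 1 - j"
  define x where "x = 2 * pi * of_int l / real n"
  have r: "r > 0" using cos_pi_over_pos[OF n] by (simp add: r_def)
  have cos: "0 \<le> cos \<phi>" "cos \<phi> \<le> r"
  proof -
    have "0 \<le> pi / real n" by simp
    then have "0 \<le> \<phi>" "\<phi> \<le> pi" using \<phi> pi_gt_zero by linarith+
    then show "0 \<le> cos \<phi>" "cos \<phi> \<le> r"
      unfolding r_def using \<phi> by (auto intro!: cos_ge_zero cos_monotone_0_pi_le)
  qed
  have bound: "cos \<phi> * cos (x - \<phi>) \<le> r * r"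
  proof (cases "int n dvd l")
    case True
    then obtain q where "l = int n * q" by blast
    then have "x - \<phi> = - \<phi> + of_int q * (2 * pi)"
      using n by (simp add: x_def)
    then have "cos (x - \<phi>) = cos \<phi>"
      using cos.plus_of_int[of "- \<phi>" q] by (simp only: of_real_eq_id id_apply cos_minus)
    then show ?thesis using cos by (simp add: mult_mono)
  next
    case False
    have "2 * (cos \<phi> * cos (x - \<phi>)) = cos x + cos (2 * \<phi> - x)"
      using cos_times_cos[of \<phi> "x - \<phi>"] by simp
    also have "\<dots> \<le> cos (2 * pi / real n) + 1"
      using n False unfolding x_def by (intro add_mono cos_multiple_le_cos_step) auto
    also have "\<dots> = 2 * (r * r)"
      using cos_double_cos[of "pi / real n"] by (simp add: r_def power2_eq_square)
    finally show ?thesis by simp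
  qed
  have arg: "(2 * of_int k + 1) * pi / real n - (\<phi> - pi / real n + 2 * pi * of_int j / real n) = x - \<phi>"
    using n by (simp add: x_def l_def field_simps)
  have "inner (side_normal n k) (inscribed_vertex n \<phi> * unit_vertex n j) = cos \<phi> / r * cos (x - \<phi>)"
    by (simp add: inscribed_vertex_def side_normal_def unit_vertex_def cis_mult inner_cis_cis arg flip: r_def)
  also have "\<dots> \<le> r"
    using bound r by (simp add: divide_le_eq)
  finally show "inner (side_normal n k) (inscribed_vertex n \<phi> * unit_vertex n j) \<le> cos (pi / real n)"
    by (simp add: r_def)
qed

lemma inscribed_ngon_subset:
  assumes "n \<ge> 3" "pi / real n \<le> \<phi>" "\<phi> \<le> pi / 2"
  shows "(\<lambda>z. inscribed_vertex n \<phi> * z) ` unit_ngon n \<subseteq> unit_ngon n"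
proof -
  have "(\<lambda>z. inscribed_vertex n \<phi> * z) ` unit_ngon n = convex hull ((\<lambda>z. inscribed_vertex n \<phi> * z) ` range (unit_vertex n))"
    unfolding unit_ngon_def by (simp add: convex_hull_linear_image linear_times)
  also have "\<dots> \<subseteq> unit_ngon n"
    using inscribed_vertex_in_unit_ngon[OF assms] by (intro hull_minimal convex_unit_ngon) auto
  finally show ?thesis .
qed

text \<open>Multiplication by \<open>b = inscribed_vertex n \<phi>\<close> carries the side functionals of the outer polygon to
  those of the inner one, whose sides lie on the lines of the rotated chords.\<close>

lemma inscribed_ngon_halfplane:
  assumes n: "n \<ge> 3" and \<phi>: "0 \<le> cos \<phi>" and z: "z \<in> unit_ngon n"
  shows "inner (cis \<phi> * unit_vertex n j) (inscribed_vertex n \<phi> * z) \<le> cos \<phi>"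
proof -
  define r where "r = cos (pi / real n)"
  have r: "r > 0" using cos_pi_over_pos[OF n] by (simp add: r_def)
  have "\<phi> + 2 * pi * of_int j / real n = (2 * of_int j + 1) * pi / real n + (\<phi> - pi / real n)"
    using n by (simp add: field_simps)
  then have arg: "cis \<phi> * unit_vertex n j = cis ((2 * of_int j + 1) * pi / real n + (\<phi> - pi / real n))"
    by (simp only: unit_vertex_def cis_mult)
  have "inner (cis \<phi> * unit_vertex n j) (inscribed_vertex n \<phi> * z)
      = cos \<phi> / r * inner (side_normal n j) z"
    unfolding arg inscribed_vertex_def r_def[symmetric] mult_scaleR_left inner_scaleR_right inner_cis_rotate
    by (simp add: side_normal_def)
  also have "\<dots> \<le> cos \<phi> / r * r"
    using unit_ngon_halfplane[OF n z, of j] \<phi> r by (intro mult_left_mono) (auto simp: r_def)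
  finally show ?thesis using r by simp
qed

text \<open>The foot of the perpendicular from the centre to the chord is at parameter \<open>sin \<phi>\<close> on the ray from
  \<open>1\<close>, and half a side of the inner polygon has length \<open>\<tau>\<close>.\<close>

lemma inscribed_side_on_line:
  fixes \<phi> :: real
  assumes n: "n \<ge> 3"
  defines "\<tau> \<equiv> cos \<phi> * tan (pi / real n)"
  shows "inscribed_vertex n \<phi> = 1 + (sin \<phi> - \<tau>) *\<^sub>R (\<i> * cis \<phi>)"
    and "inscribed_vertex n \<phi> * unit_vertex n 1 = 1 + (sin \<phi> + \<tau>) *\<^sub>R (\<i> * cis \<phi>)"
proof -
  define \<beta> where "\<beta> = pi / real n"
  have r: "cos \<beta> > 0" using cos_pi_over_pos[OF n] by (simp add: \<beta>_def)
  have point: "cis \<phi> * (cis (- \<phi>) + t *\<^sub>R \<i>) = 1 + t *\<^sub>R (\<i> * cis \<phi>)" for t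
    by (simp add: distrib_left cis_mult mult.commute)
  have tan: "cos \<beta> * tan \<beta> = sin \<beta>" using r by (simp add: tan_def)
  have "inscribed_vertex n \<phi> = cis \<phi> * ((cos \<phi> / cos \<beta>) *\<^sub>R cis (- \<beta>))"
    by (simp add: inscribed_vertex_def cis_mult flip: \<beta>_def)
  also have "(cos \<phi> / cos \<beta>) *\<^sub>R cis (- \<beta>) = cis (- \<phi>) + (sin \<phi> - \<tau>) *\<^sub>R \<i>"
    using r tan by (simp add: complex_eq_iff \<tau>_def tan_def flip: \<beta>_def)
  finally show "inscribed_vertex n \<phi> = 1 + (sin \<phi> - \<tau>) *\<^sub>R (\<i> * cis \<phi>)"
    by (simp only: point)
  have "\<phi> - \<beta> + 2 * pi * of_int 1 / real n = \<phi> + \<beta>"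
    by (simp add: \<beta>_def)
  then have "inscribed_vertex n \<phi> * unit_vertex n 1 = cis \<phi> * ((cos \<phi> / cos \<beta>) *\<^sub>R cis \<beta>)"
    unfolding inscribed_vertex_def unit_vertex_def \<beta>_def[symmetric] mult_scaleR_left mult_scaleR_right cis_mult
    by (simp only:)
  also have "(cos \<phi> / cos \<beta>) *\<^sub>R cis \<beta> = cis (- \<phi>) + (sin \<phi> + \<tau>) *\<^sub>R \<i>"
    using r tan by (simp add: complex_eq_iff \<tau>_def tan_def flip: \<beta>_def)
  finally show "inscribed_vertex n \<phi> * unit_vertex n 1 = 1 + (sin \<phi> + \<tau>) *\<^sub>R (\<i> * cis \<phi>)"
    by (simp only: point)
qed

text \<open>A line through two points is at a well-defined distance from \<open>0\<close>. The conclusion is squared because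
  the two unit normals \<open>cis \<phi>\<close> and \<open>cis \<psi>\<close> may be opposite.\<close>

lemma common_line_same_distance:
  assumes A: "inner (cis \<psi>) A = p" "inner (cis \<psi>) (A + t *\<^sub>R (\<i> * cis \<phi>)) = p"
    and "t \<noteq> 0" "inner (cis \<phi>) A = d"
  shows "d\<^sup>2 = p\<^sup>2"
proof -
  have "inner (cis \<psi>) (\<i> * cis \<phi>) = 0"
    using assms by (simp add: inner_add_right)
  then have s: "sin (\<psi> - \<phi>) = 0"
    by (simp add: inner_complex_def sin_diff algebra_simps)
  then have c: "(cos (\<psi> - \<phi>))\<^sup>2 = 1"
    by (metis add_0 cos_squared_eq diff_zero power_zero_numeral)
  have "cos \<psi> = cos ((\<psi> - \<phi>) + \<phi>)" "sin \<psi> = sin ((\<psi> - \<phi>) + \<phi>)" by simp_all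
  then have "cos \<psi> = cos (\<psi> - \<phi>) * cos \<phi>" "sin \<psi> = cos (\<psi> - \<phi>) * sin \<phi>"
    unfolding cos_add sin_add s by simp_all
  then have "inner (cis \<psi>) A = cos (\<psi> - \<phi>) * inner (cis \<phi>) A"
    by (simp add: inner_complex_def algebra_simps)
  then show ?thesis using assms c by (simp add: power_mult_distrib)
qed

text \<open>The endpoint is the last point of the polygon on the ray from \<open>1\<close> in the direction
  \<open>\<i> * cis \<phi>\<close>. Both endpoints of the inner side lie in the polygon, so neither is beyond the last point.\<close>

lemma chord_endpoint:
  assumes n: "n \<ge> 3" and \<phi>: "pi / real n < \<phi>" "\<phi> < pi / 2"
  obtains S where "S \<in> frontier (unit_ngon n)"
    and "on_opposite_side (unit_ngon n) 1 S"
    and "closed_segment (inscribed_vertex n \<phi>) (inscribed_vertex n \<phi> * unit_vertex n 1) \<subseteq> closed_segment 1 S"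
    and "\<And>z. z \<in> closed_segment 1 S \<Longrightarrow> inner (cis \<phi>) z = cos \<phi>"
proof -
  define r where "r = cos (pi / real n)"
  define f where "f t = 1 + t *\<^sub>R (\<i> * cis \<phi>)" for t :: real
  define X where "X = {t. f t \<in> unit_ngon n}"
  define \<tau> where "\<tau> = cos \<phi> * tan (pi / real n)"
  \<comment> \<open>The parameters at which the ray passes through the two endpoints of the inner side.\<close>
  define t1 where "t1 = sin \<phi> - \<tau>"
  define t2 where "t2 = sin \<phi> + \<tau>"
  have n0: "0 < pi / real n" using n by simp
  have r: "r > 0" using cos_pi_over_pos[OF n] by (simp add: r_def)
  have cos: "0 < cos \<phi>" "cos \<phi> < r"
    unfolding r_def using \<phi> n0
    by (auto intro!: cos_gt_zero cos_monotone_0_pi)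
  have "tan (pi / real n) > 0"
    using \<phi> n0 by (intro tan_gt_zero) linarith+
  then have \<tau>: "\<tau> > 0"
    unfolding \<tau>_def using cos by simp
  have f1: "f t1 = inscribed_vertex n \<phi>" and f2: "f t2 = inscribed_vertex n \<phi> * unit_vertex n 1"
    using inscribed_side_on_line[OF n, of \<phi>] by (simp_all add: f_def t1_def t2_def \<tau>_def)
  have "r * t1 = sin (\<phi> - pi / real n)"
    using r by (simp add: t1_def \<tau>_def tan_def sin_diff algebra_simps flip: r_def)
  moreover have "sin (\<phi> - pi / real n) > 0"
    using \<phi> n0 by (intro sin_gt_zero) auto
  ultimately have t1: "0 < t1" using r by (metis zero_less_mult_pos)
  have t12: "t1 < t2" using \<tau> by (simp add: t1_def t2_def)
  have t2X: "t2 \<in> X"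
    using inscribed_vertex_in_unit_ngon[OF n, of \<phi> 1] \<phi> by (simp add: X_def f2)
  have norm_f: "norm (f t - f s) = \<bar>t - s\<bar>" for s t
    by (simp add: f_def norm_mult flip: scaleR_diff_left)
  have contf: "continuous_on UNIV f"
    unfolding f_def by (intro continuous_intros)
  have "compact X"
  proof -
    have "closed X"
      unfolding X_def using n compact_unit_ngon[of n] contf
      by (intro closed_vimage[unfolded vimage_def]) (auto simp: compact_imp_closed)
    moreover have "bounded X"
    proof -
      obtain B where B: "\<And>z. z \<in> unit_ngon n \<Longrightarrow> norm z \<le> B"
        using compact_imp_bounded[OF compact_unit_ngon, of n] n by (auto simp: bounded_iff)
      have "\<bar>t\<bar> \<le> B + 1" if "t \<in> X" for t
        using norm_triangle_ineq4[of "f t" "f 0"] norm_f[of t 0] B[of "f t"] that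
        by (simp add: X_def f_def[of 0])
      then show ?thesis by (auto simp: bounded_iff)
    qed
    ultimately show ?thesis by (simp add: compact_eq_bounded_closed)
  qed
  then obtain t3 where t3: "t3 \<in> X" and max: "\<And>t. t \<in> X \<Longrightarrow> t \<le> t3"
    using compact_attains_sup[of X] t2X by auto
  have t23: "t2 \<le> t3" using max t2X by simp
  define S where "S = f t3"
  have SP: "S \<in> unit_ngon n" using t3 by (simp add: S_def X_def)
  have front: "S \<in> frontier (unit_ngon n)"
  proof -
    have "S \<notin> interior (unit_ngon n)"
    proof
      assume "S \<in> interior (unit_ngon n)"
      then obtain e where e: "e > 0" "ball S e \<subseteq> unit_ngon n"
        by (auto simp: mem_interior)
      have "f (t3 + e / 2) \<in> ball S e"
        using e norm_f[of t3 "t3 + e/2"] by (simp add: S_def dist_norm)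
      then have "t3 + e / 2 \<in> X" using e by (auto simp: X_def)
      then show False using max e by fastforce
    qed
    then show ?thesis
      using SP closure_subset by (auto simp: frontier_def)
  qed
  have seg: "closed_segment 1 S = f ` {0..t3}"
  proof -
    have "closed_segment 1 S = {f (u * t3) | u. 0 \<le> u \<and> u \<le> 1}"
      unfolding closed_segment_def by (simp add: S_def f_def algebra_simps)
    also have "\<dots> = f ` {0..t3}"
    proof safe
      fix u :: real assume "0 \<le> u" "u \<le> 1"
      then show "f (u * t3) \<in> f ` {0..t3}"
        using t1 t12 t23 by (intro imageI) (auto simp: mult_left_le_one_le)
    next
      fix t assume "t \<in> {0..t3}"
      then show "\<exists>u. f t = f (u * t3) \<and> 0 \<le> u \<and> u \<le> 1"
        using t1 t12 t23 by (intro exI[of _ "t / t3"]) auto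
    qed
    finally show ?thesis .
  qed
  have line: "inner (cis \<phi>) (f t) = cos \<phi>" for t
    by (simp add: f_def inner_complex_def algebra_simps)
  have opp: "on_opposite_side (unit_ngon n) 1 S"
  proof -
    obtain k where k: "S \<in> closed_segment (unit_vertex n k) (unit_vertex n (k + 1))"
      using frontier_unit_ngon[OF n front] .
    define e where "e = unit_ngon n \<inter> {z. inner (side_normal n k) z = cos (pi / real n)}"
    have "convex {z. inner (side_normal n k) z = cos (pi / real n)}"
      by (rule convex_hyperplane)
    then have "closed_segment (unit_vertex n k) (unit_vertex n (k + 1)) \<subseteq> {z. inner (side_normal n k) z = cos (pi / real n)}"
      using n by (intro closed_segment_subset) (auto simp: inner_side_normal_left inner_side_normal_right)
    then have Se: "S \<in> e" using k SP by (auto simp: e_def)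
    have "1 \<notin> e"
    proof
      assume "1 \<in> e"
      then have "(cos \<phi>)\<^sup>2 = (cos (pi / real n))\<^sup>2"
        using Se t1 t12 t23 line[of 0]
        by (intro common_line_same_distance[of "(2 * of_int k + 1) * pi / real n" 1 _ t3 \<phi>])
           (simp_all add: e_def S_def f_def flip: side_normal_def)
      then show False using cos r by (simp add: power2_eq_iff flip: r_def)
    qed
    then show ?thesis
      using Se unit_ngon_edge[OF n, of k] unfolding on_opposite_side_def e_def by blast
  qed
  have "f t1 \<in> closed_segment 1 S" "f t2 \<in> closed_segment 1 S"
    unfolding seg using t1 t12 t23 by auto
  then have "closed_segment (f t1) (f t2) \<subseteq> closed_segment 1 S"
    by (intro closed_segment_subset) auto
  moreover have "inner (cis \<phi>) z = cos \<phi>" if "z \<in> closed_segment 1 S" for z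
    using that line by (auto simp: seg)
  ultimately show ?thesis
    using that[of S] front opp by (simp add: f1 f2)
qed

section \<open>Area under similarities of the complex plane\<close>

text \<open>Rotation invariance of Lebesgue measure is a statement about \<open>real^'n\<close>; this isometry carries it
  over to the complex plane.\<close>

definition real2_of_complex :: "complex \<Rightarrow> real^2" where
  "real2_of_complex z = vector [Re z, Im z]"

text \<open>Lebesgue measure is determined by its values on boxes, and the identification preserves boxes.\<close>

lemma measure_real2_of_complex:
  assumes "compact S"
  shows "measure lborel (real2_of_complex ` S) = measure lborel S" and "compact (real2_of_complex ` S)"
proof -
  have cont: "continuous_on UNIV real2_of_complex"
  proof -
    have "real2_of_complex = (\<lambda>z. \<chi> i. if i = 1 then Re z else Im z)"
      by (auto simp: real2_of_complex_def fun_eq_iff vec_eq_iff forall_2)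
    moreover have "continuous_on UNIV (\<lambda>z. if i = 1 then Re z else Im z)" for i :: 2
      by (cases "i = 1") (auto intro!: continuous_intros)
    then have "continuous_on UNIV (\<lambda>z. \<chi> i. if (i :: 2) = 1 then Re z else Im z)"
      by (rule continuous_on_vec_lambda)
    ultimately show ?thesis by (simp only:)
  qed
  then have [measurable]: "real2_of_complex \<in> borel_measurable borel"
    by (rule borel_measurable_continuous_onI)
  have inj: "inj real2_of_complex"
    by (intro injI) (metis complex_eqI real2_of_complex_def vector_2)
  have eq: "lborel = distr lborel borel real2_of_complex"
  proof (rule lborel_eqI)
    fix l u :: "real^2" assume le: "\<And>b. b \<in> Basis \<Longrightarrow> l \<bullet> b \<le> u \<bullet> b"
    have le12: "l $ 1 \<le> u $ 1" "l $ 2 \<le> u $ 2"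
      using le[of "axis 1 1"] le[of "axis 2 1"] by (auto simp: inner_axis axis_in_Basis_iff)
    have "real2_of_complex -` box l u = box (Complex (l $ 1) (l $ 2)) (Complex (u $ 1) (u $ 2))"
      by (auto simp: mem_box_cart forall_2 in_box_complex_iff real2_of_complex_def)
    then have "emeasure (distr lborel borel real2_of_complex) (box l u)
        = emeasure lborel (box (Complex (l $ 1) (l $ 2)) (Complex (u $ 1) (u $ 2)))"
      by (simp add: emeasure_distr)
    also have "\<dots> = ennreal ((u $ 1 - l $ 1) * (u $ 2 - l $ 2))"
      using le12 by (subst emeasure_lborel_box) (auto simp: Basis_complex_def inner_complex_def)
    also have "(u $ 1 - l $ 1) * (u $ 2 - l $ 2) = (\<Prod>b\<in>Basis. (u - l) \<bullet> b)"
    proof -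
      have B: "(Basis :: (real^2) set) = {axis 1 1, axis 2 1}"
        by (auto simp: Basis_vec_def UNIV_2)
      show ?thesis unfolding B by (subst prod.insert) (auto simp: inner_axis axis_eq_axis)
    qed
    finally show "emeasure (distr lborel borel real2_of_complex) (box l u) = ennreal (\<Prod>b\<in>Basis. (u - l) \<bullet> b)" .
  qed simp
  show comp: "compact (real2_of_complex ` S)"
    using assms cont by (intro compact_continuous_image) (auto intro: continuous_on_subset)
  have "measure (distr lborel borel real2_of_complex) (real2_of_complex ` S)
      = measure lborel (real2_of_complex -` real2_of_complex ` S)"
    using comp by (subst measure_distr) (auto simp: borel_compact)
  then show "measure lborel (real2_of_complex ` S) = measure lborel S"
    using inj by (simp add: inj_vimage_image_eq flip: eq)
qed

lemma measure_rotate_complex: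
  assumes S: "compact S"
  shows "measure lborel ((\<lambda>z. cis \<theta> * z) ` S) = measure lborel S"
proof -
  define R where "R v = real2_of_complex (cis \<theta> * Complex (v $ 1) (v $ 2))" for v :: "real^2"
  have "linear R"
    by (rule linearI)
       (simp_all add: R_def real2_of_complex_def vec_eq_iff forall_2 algebra_simps)
  moreover have "norm (R v) = norm v" for v
  proof -
    have "norm (real2_of_complex z) = norm z" for z
      by (simp add: real2_of_complex_def norm_vec_def L2_set_def sum_2 cmod_def)
    then have "norm (R v) = norm (Complex (v $ 1) (v $ 2))"
      by (simp add: R_def norm_mult)
    then show ?thesis by (simp add: norm_vec_def L2_set_def sum_2 cmod_def)
  qed
  ultimately have R: "orthogonal_transformation R"
    by (simp add: orthogonal_transformation)
  have rot: "compact ((\<lambda>z. cis \<theta> * z) ` S)"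
    using S by (intro compact_continuous_image continuous_intros)
  have "real2_of_complex ` (\<lambda>z. cis \<theta> * z) ` S = R ` real2_of_complex ` S"
    unfolding image_image R_def by (simp add: real2_of_complex_def)
  then have "measure lborel ((\<lambda>z. cis \<theta> * z) ` S) = measure lborel (R ` real2_of_complex ` S)"
    using measure_real2_of_complex(1)[OF rot] by simp
  also have "\<dots> = measure lebesgue (R ` real2_of_complex ` S)"
    using measure_real2_of_complex(2)[OF rot] \<open>_ = R ` _\<close> by (simp add: borel_compact)
  also have "\<dots> = measure lebesgue (real2_of_complex ` S)"
    using measure_real2_of_complex(2)[OF S] by (intro measure_orthogonal_image R lmeasurable_compact)
  also have "\<dots> = measure lborel S"
    using measure_real2_of_complex[OF S] by (simp add: borel_compact)
  finally show ?thesis .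
qed

lemma measure_similarity_complex:
  fixes a c :: complex
  assumes S: "compact S"
  shows "measure lborel ((\<lambda>z. c + a * z) ` S) = (norm a)\<^sup>2 * measure lborel S"
proof -
  obtain \<theta> where a: "a = norm a *\<^sub>R cis \<theta>"
    using rcis_cmod_Arg[of a] by (metis rcis_def scaleR_conv_of_real)
  let ?R = "(\<lambda>z. cis \<theta> * z) ` S"
  have R: "compact ?R"
    using S by (intro compact_continuous_image continuous_intros)
  have "c + a * z = norm a *\<^sub>R (cis \<theta> * z) + c" for z
    by (subst a) (simp only: mult_scaleR_left add.commute)
  then have eq: "(\<lambda>z. c + a * z) ` S = (\<lambda>z. norm a *\<^sub>R z + c) ` ?R"
    by (simp only: image_image)
  have "compact ((\<lambda>z. c + a * z) ` S)"
    using S by (intro compact_continuous_image continuous_intros)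
  then have "measure lborel ((\<lambda>z. c + a * z) ` S) = measure lebesgue ((\<lambda>z. norm a *\<^sub>R z + c) ` ?R)"
    by (simp add: borel_compact flip: eq)
  also have "\<dots> = (norm a)\<^sup>2 * measure lebesgue ?R"
    by (subst measure_lebesgue_affine) simp
  also have "measure lebesgue ?R = measure lborel S"
    using measure_rotate_complex[OF S] R by (simp add: borel_compact)
  finally show ?thesis .
qed

section \<open>Similarities and regular polygons\<close>

text \<open>A connected set that contains \<open>c\<close> and leaves \<open>interior T\<close> would have to cross the frontier, which
  lies in \<open>K\<close>.\<close>

lemma connected_component_interior_convex:
  fixes T :: "'a::euclidean_space set"
  assumes "convex T" "c \<in> interior T" "frontier T \<subseteq> K" "interior T \<inter> K = {}"
  shows "connected_component_set (- K) c = interior T"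
proof (rule connected_component_unique)
  fix X assume X: "c \<in> X" "X \<subseteq> - K" "connected X"
  show "X \<subseteq> interior T"
  proof (rule ccontr)
    assume "\<not> X \<subseteq> interior T"
    moreover have "X \<inter> frontier (interior T) = {}"
      using X assms frontier_interior_subset by blast
    ultimately show False
      using connected_Int_frontier[OF X(3), of "interior T"] X(1) assms(2) by blast
  qed
qed (use assms in \<open>auto intro: convex_connected convex_interior\<close>)

lemma frontier_affine_image:
  fixes a c :: complex
  assumes "a \<noteq> 0"
  shows "frontier ((\<lambda>z. c + a * z) ` S) = (\<lambda>z. c + a * z) ` frontier S"
    and "interior ((\<lambda>z. c + a * z) ` S) = (\<lambda>z. c + a * z) ` interior S"
proof -
  have lin: "linear ((*) a)" and inj: "inj ((*) a)"
    using assms by (auto simp: linear_times inj_on_def)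
  have split: "(\<lambda>z. c + a * z) ` X = (+) c ` (*) a ` X" for X
    by (simp add: image_image)
  have int: "interior ((*) a ` S) = (*) a ` interior S"
    using interior_injective_linear_image[OF lin inj] .
  then show "interior ((\<lambda>z. c + a * z) ` S) = (\<lambda>z. c + a * z) ` interior S"
    unfolding split interior_translation by simp
  have "frontier ((*) a ` S) = (*) a ` frontier S"
    unfolding frontier_def int closure_injective_linear_image[OF lin inj, symmetric]
    using inj by (simp add: image_set_diff)
  then show "frontier ((\<lambda>z. c + a * z) ` S) = (\<lambda>z. c + a * z) ` frontier S"
    unfolding split frontier_translation by simp
qed

lemma on_opposite_side_affine_image:
  assumes a: "a \<noteq> 0" and S: "on_opposite_side P A S"
  shows "on_opposite_side ((\<lambda>z. c + a * z) ` P) (c + a * A) (c + a * S)"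
proof -
  obtain e where e: "e face_of P" "aff_dim e = 1" "A \<notin> e" "S \<in> e"
    using S by (auto simp: on_opposite_side_def edge_of_def)
  have lin: "linear ((*) a)" and inj: "inj ((*) a)"
    using a by (auto simp: linear_times inj_on_def)
  have split: "(\<lambda>z. c + a * z) ` X = (+) c ` (*) a ` X" for X
    by (simp add: image_image)
  have "(\<lambda>z. c + a * z) ` e face_of (\<lambda>z. c + a * z) ` P"
    unfolding split using e(1) lin inj by (simp only: face_of_translation_eq face_of_linear_image)
  moreover have "aff_dim ((\<lambda>z. c + a * z) ` e) = 1"
    unfolding split using e(2) lin inj by (simp only: aff_dim_translation_eq aff_dim_injective_linear_image)
  moreover have "c + a * A \<notin> (\<lambda>z. c + a * z) ` e" using a e(3) by auto
  moreover have "c + a * S \<in> (\<lambda>z. c + a * z) ` e" using e(4) by blast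
  ultimately show ?thesis
    unfolding on_opposite_side_def edge_of_def by blast
qed

lemma rotate_about_affine:
  "rotate_about c (2 * pi * real k / real n) (c + a * z) = c + a * (unit_vertex n (int k) * z)"
  by (simp add: rotate_about_def unit_vertex_def mult_ac)

lemma regular_ngon_hull:
  assumes "n > 0"
  shows "convex hull ((\<lambda>k. rotate_about c (2 * pi * real k / real n) (c + a)) ` {..<n})
    = (\<lambda>z. c + a * z) ` unit_ngon n"
proof -
  have "(\<lambda>k. rotate_about c (2 * pi * real k / real n) (c + a)) ` {..<n}
      = (+) c ` (*) a ` range (unit_vertex n)"
    using rotate_about_affine[of c _ n a 1] assms by (simp add: range_unit_vertex image_image)
  then have "convex hull ((\<lambda>k. rotate_about c (2 * pi * real k / real n) (c + a)) ` {..<n})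
      = (+) c ` (*) a ` unit_ngon n"
    by (simp add: unit_ngon_def convex_hull_translation convex_hull_linear_image linear_times)
  then show ?thesis by (simp add: image_image)
qed

lemma regular_ngon_affine_image:
  assumes "n \<ge> 3" "a \<noteq> 0"
  shows "regular_ngon n c ((\<lambda>z. c + a * z) ` unit_ngon n)"
  unfolding regular_ngon_def
  using assms regular_ngon_hull[of n c a] by (intro conjI exI[of _ "c + a"]) auto

text \<open>Any vertex may serve as the generating one, since the polygon on the roots of unity is invariant
  under multiplication by a root of unity. This reduces the theorem to the vertex \<open>1\<close>.\<close>

lemma regular_ngon_at_vertex:
  assumes P: "regular_ngon n c P" and A: "A extreme_point_of P"
  shows "A \<noteq> c" and "P = (\<lambda>z. c + (A - c) * z) ` unit_ngon n"
proof -
  obtain v where n: "n \<ge> 3" and v: "v \<noteq> c"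
    and Peq: "P = convex hull ((\<lambda>k. rotate_about c (2 * pi * real k / real n) v) ` {..<n})"
    using P by (auto simp: regular_ngon_def)
  obtain k where k: "A = rotate_about c (2 * pi * real k / real n) v"
    using A extreme_point_of_convex_hull unfolding Peq by blast
  then have Ac: "A - c = (v - c) * unit_vertex n (int k)"
    by (simp add: rotate_about_def unit_vertex_def mult_ac)
  then show "A \<noteq> c" using v by auto
  have "P = (\<lambda>z. c + (v - c) * z) ` unit_ngon n"
    using regular_ngon_hull[of n c "v - c"] n by (simp add: Peq)
  also have "\<dots> = (\<lambda>z. c + (v - c) * z) ` (\<lambda>z. unit_vertex n (int k) * z) ` unit_ngon n"
    by (simp only: unit_ngon_rotate)
  also have "\<dots> = (\<lambda>z. c + (A - c) * z) ` unit_ngon n"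
    by (simp add: image_image Ac mult.assoc)
  finally show "P = (\<lambda>z. c + (A - c) * z) ` unit_ngon n" .
qed

lemma Union_area_chordal_system:
  "\<Union> (area_chordal_system n c (c + a * A) (c + a * S))
    = (\<lambda>z. c + a * z) ` (\<Union>k<n. (\<lambda>z. unit_vertex n (int k) * z) ` closed_segment A S)"
proof -
  have "closed_segment (c + a * A) (c + a * S) = (+) c ` closed_segment (a * A) (a * S)"
    by (rule closed_segment_translation)
  also have "\<dots> = (\<lambda>z. c + a * z) ` closed_segment A S"
    by (simp add: closed_segment_linear_image linear_times image_image)
  finally have seg: "closed_segment (c + a * A) (c + a * S) = (\<lambda>z. c + a * z) ` closed_segment A S" .
  show ?thesis
    unfolding area_chordal_system_def seg image_image rotate_about_affine image_UN by simp
qed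

section \<open>The polygon bounded by the chords\<close>

text \<open>The rotated chords cover the sides of the inner polygon and lie on the lines that support it, so
  they cover its frontier and miss its interior.\<close>

lemma produced_polygon_eq:
  assumes n: "n \<ge> 3" and \<phi>: "cos \<phi> > 0" and a: "a \<noteq> 0"
    and side: "closed_segment (inscribed_vertex n \<phi>) (inscribed_vertex n \<phi> * unit_vertex n 1) \<subseteq> closed_segment 1 S"
    and line: "\<And>z. z \<in> closed_segment 1 S \<Longrightarrow> inner (cis \<phi>) z = cos \<phi>"
  shows "produced_polygon n c (c + a) (c + a * S) = (\<lambda>z. c + a * inscribed_vertex n \<phi> * z) ` unit_ngon n"
proof -
  define b where "b = inscribed_vertex n \<phi>"
  define g where "g z = c + a * z" for z
  define T0 where "T0 = (\<lambda>z. b * z) ` unit_ngon n"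
  define K0 where "K0 = (\<Union>k<n. (\<lambda>z. unit_vertex n (int k) * z) ` closed_segment 1 S)"
  define T where "T = g ` T0"
  have b0: "b \<noteq> 0"
    using \<phi> cos_pi_over_pos[OF n] by (simp add: b_def inscribed_vertex_def)
  have Teq: "T = (\<lambda>z. c + a * b * z) ` unit_ngon n"
    by (simp add: T_def T0_def g_def image_image mult.assoc)
  have convex0: "convex T0"
    unfolding T0_def by (intro convex_linear_image convex_unit_ngon linear_times)
  have convex: "convex T"
    using convex_translation[OF convex_linear_image[OF linear_times convex0, of a], of c]
    by (simp add: T_def g_def image_image)
  have compact: "compact T"
    unfolding Teq using compact_unit_ngon[of n] n
    by (intro compact_continuous_image continuous_intros) auto
  have frontier0: "frontier T0 \<subseteq> K0"
  proof
    fix y assume "y \<in> frontier T0"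
    then obtain x where x: "x \<in> frontier (unit_ngon n)" and y: "y = b * x"
      using frontier_affine_image(1)[OF b0, of 0] by (auto simp: T0_def)
    obtain k where k: "x \<in> closed_segment (unit_vertex n k) (unit_vertex n (k + 1))"
      using frontier_unit_ngon[OF n x] .
    \<comment> \<open>The chord system is indexed by \<open>{..<n}\<close>, the sides by all integers.\<close>
    define j where "j = nat (k mod int n)"
    have j: "j < n" "unit_vertex n (int j) = unit_vertex n k"
      using n by (auto simp: j_def nat_less_iff unit_vertex_mod)
    have "y \<in> (\<lambda>z. b * z) ` closed_segment (unit_vertex n k) (unit_vertex n (k + 1))"
      using k y by blast
    also have "\<dots> = closed_segment (b * unit_vertex n k) (b * unit_vertex n (k + 1))"
      by (rule closed_segment_linear_image[OF linear_times, symmetric])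
    also have "\<dots> = closed_segment (unit_vertex n k * b) (unit_vertex n k * (b * unit_vertex n 1))"
      by (simp add: unit_vertex_add mult_ac)
    also have "\<dots> = (\<lambda>z. unit_vertex n k * z) ` closed_segment b (b * unit_vertex n 1)"
      by (rule closed_segment_linear_image[OF linear_times])
    also have "\<dots> \<subseteq> (\<lambda>z. unit_vertex n k * z) ` closed_segment 1 S"
      using side by (auto simp: b_def)
    finally have "y \<in> (\<lambda>z. unit_vertex n (int j) * z) ` closed_segment 1 S"
      by (simp only: j(2))
    then show "y \<in> K0"
      unfolding K0_def using j(1) by blast
  qed
  have disjoint0: "interior T0 \<inter> K0 = {}"
  proof -
    have "y \<notin> interior T0" if "x \<in> closed_segment 1 S" "y = unit_vertex n k * x" for k x y
    proof
      assume y: "y \<in> interior T0"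
      have "T0 \<subseteq> {z. inner (cis \<phi> * unit_vertex n k) z \<le> cos \<phi>}"
        using inscribed_ngon_halfplane[OF n, of \<phi>] \<phi> by (auto simp: T0_def b_def)
      then have "y \<in> interior {z. inner (cis \<phi> * unit_vertex n k) z \<le> cos \<phi>}"
        using y interior_mono by blast
      then have "inner (cis \<phi> * unit_vertex n k) y < cos \<phi>"
        by (subst (asm) interior_halfspace_le) auto
      moreover have "inner (cis \<phi> * unit_vertex n k) y = inner (cis \<phi>) x"
        unfolding that(2) unit_vertex_def cis_mult by (rule inner_cis_rotate)
      ultimately show False using line[OF that(1)] by simp
    qed
    then show ?thesis unfolding K0_def by blast
  qed
  have zero: "0 \<in> interior T0"
    using zero_interior_unit_ngon[OF n] frontier_affine_image(2)[OF b0, of 0 "unit_ngon n"]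
    by (auto simp: T0_def)
  have g_images: "frontier T = g ` frontier T0" "interior T = g ` interior T0"
    unfolding T_def g_def by (rule frontier_affine_image[OF a])+
  have "inj g" using a by (auto simp: inj_on_def g_def)
  then have "interior T \<inter> g ` K0 = {}"
    using disjoint0 by (simp add: g_images flip: image_Int)
  moreover have "frontier T \<subseteq> g ` K0"
    unfolding g_images using frontier0 by (rule image_mono)
  moreover have centre: "c \<in> interior T"
    unfolding g_images using imageI[OF zero, of g] by (simp add: g_def)
  ultimately have "connected_component_set (- g ` K0) c = interior T"
    using convex by (intro connected_component_interior_convex)
  moreover have "\<Union> (area_chordal_system n c (c + a) (c + a * S)) = g ` K0"
    using Union_area_chordal_system[of n c a 1 S] by (simp add: K0_def g_def[abs_def])
  ultimately have "produced_polygon n c (c + a) (c + a * S) = closure (interior T)"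
    by (simp add: produced_polygon_def)
  also have "\<dots> = T"
    using convex compact centre
    by (subst convex_closure_interior) (auto simp: compact_imp_closed)
  finally show ?thesis by (simp add: Teq b_def)
qed

section \<open>Every ratio of areas is attained\<close>

lemma measure_unit_ngon_pos:
  assumes n: "n \<ge> 3"
  shows "measure lborel (unit_ngon n) > 0"
proof -
  obtain e where e: "e > 0" "ball 0 e \<subseteq> unit_ngon n"
    using zero_interior_unit_ngon[OF n] by (auto simp: mem_interior)
  have "0 < measure lborel (ball (0::complex) e)"
    using e by (simp add: content_ball_pos)
  also have "\<dots> \<le> measure lborel (unit_ngon n)"
    using e compact_unit_ngon[of n] n
    by (intro measure_mono_fmeasurable fmeasurable_compact) auto
  finally show ?thesis .
qed

theorem theorem1:
  fixes n :: nat and m :: int and c A :: complex and P :: "complex set"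
  assumes "regular_ngon n c P"
    and "A extreme_point_of P"
    and "m \<ge> 2"
  shows "\<exists>S \<in> frontier P. on_opposite_side P A S \<and>
           (let T = produced_polygon n c A S in
              regular_ngon n c T \<and> T \<subseteq> P \<and>
              measure lborel P / measure lborel T = real_of_int m)"
proof -
  have n: "n \<ge> 3" using assms(1) by (simp add: regular_ngon_def)
  define a where "a = A - c"
  define r where "r = cos (pi / real n)"
  \<comment> \<open>This makes the distance of the chord from the centre \<open>cos \<phi> = r / sqrt m\<close>.\<close>
  define \<phi> where "\<phi> = arccos (r / sqrt (real_of_int m))"
  define b where "b = inscribed_vertex n \<phi>"
  have a: "a \<noteq> 0" and P: "P = (\<lambda>z. c + a * z) ` unit_ngon n"
    using regular_ngon_at_vertex[OF assms(1,2)] by (auto simp: a_def)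
  have A: "A = c + a * 1" by (simp add: a_def)
  have r: "0 < r" "r \<le> 1" using cos_pi_over_pos[OF n] by (auto simp: r_def)
  have m: "sqrt (real_of_int m) > 1" using assms(3) by simp
  then have d: "0 < r / sqrt (real_of_int m)" "r / sqrt (real_of_int m) < r"
    using r by (auto simp: divide_less_eq)
  then have cos: "cos \<phi> = r / sqrt (real_of_int m)"
    using r by (simp add: \<phi>_def)
  have range: "0 \<le> pi / real n" "pi / real n \<le> pi"
    using n by (auto simp: field_simps)
  have upper: "\<phi> < pi / 2"
    unfolding \<phi>_def using d r arccos_less_arccos[of 0 "r / sqrt (real_of_int m)"] by simp
  have "arccos r < \<phi>"
    unfolding \<phi>_def using d r by (intro arccos_less_arccos) auto
  then have lower: "pi / real n < \<phi>"
    unfolding r_def using range by (simp add: arccos_cos)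
  obtain S where S: "S \<in> frontier (unit_ngon n)" "on_opposite_side (unit_ngon n) 1 S"
    "closed_segment b (b * unit_vertex n 1) \<subseteq> closed_segment 1 S"
    "\<And>z. z \<in> closed_segment 1 S \<Longrightarrow> inner (cis \<phi>) z = cos \<phi>"
    using chord_endpoint[OF n lower upper] unfolding b_def by metis
  have b: "b \<noteq> 0" "norm b = 1 / sqrt (real_of_int m)"
    using r d m cos by (auto simp: b_def inscribed_vertex_def simp flip: r_def)
  define T where "T = (\<lambda>z. c + a * b * z) ` unit_ngon n"
  have T: "produced_polygon n c A (c + a * S) = T"
    using produced_polygon_eq[OF n _ a S(3,4)[unfolded b_def], of c] cos d by (simp add: A T_def b_def)
  have sub: "T \<subseteq> P"
    using inscribed_ngon_subset[OF n less_imp_le[OF lower] less_imp_le[OF upper]]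
    unfolding T_def P b_def by (force simp: mult.assoc)
  have area: "measure lborel P / measure lborel T = real_of_int m"
  proof -
    have "measure lborel T = (norm a)\<^sup>2 * measure lborel (unit_ngon n) / real_of_int m"
      unfolding T_def using n assms(3) b
      by (simp add: measure_similarity_complex compact_unit_ngon norm_mult power_mult_distrib power_divide)
    moreover have "measure lborel P = (norm a)\<^sup>2 * measure lborel (unit_ngon n)"
      unfolding P using n by (simp add: measure_similarity_complex compact_unit_ngon)
    ultimately show ?thesis
      using a assms(3) measure_unit_ngon_pos[OF n] by simp
  qed
  show ?thesis
  proof (intro bexI conjI)
    show "c + a * S \<in> frontier P"
      unfolding P frontier_affine_image[OF a] using S(1) by blast
    show "on_opposite_side P A (c + a * S)"
      unfolding P A using on_opposite_side_affine_image[OF a S(2)] .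
    show "let T = produced_polygon n c A (c + a * S) in regular_ngon n c T \<and> T \<subseteq> P \<and>
        measure lborel P / measure lborel T = real_of_int m"
      unfolding Let_def T using sub area regular_ngon_affine_image[OF n, of "a * b" c] a b
      by (simp add: T_def)
  qed
qed

end
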